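(* Let $\mathcal X$ be a Polish space and let $(\mathcal P_t)_{t\ge 0}$ be a Markov semigroup on $\mathcal X$ which is Feller, weakly topologically irreducible and asymptotically strong Feller. Then $(\mathcal P_t)$ admits at most one invariant probability measure.
   Context: A Markov semigroup $\mathcal P_t$ on $\mathcal X$ has transition probabilities $\mathcal P_t(x,\cdot)$ and acts on bounded measurable functions by $\mathcal P_t\phi(x)=\int\phi(y)\,\mathcal P_t(x,dy)$. Feller: $\mathcal P_t\phi$ is continuous whenever $\phi$ is bounded and continuous. Weakly topologically irreducible: for all $u_1,u_2\in\mathcal X$ there exists $v\in\mathcal X$ such that for every open set $A$ containing $v$ there exist $t_1,t_2>0$ with $\mathcal P_{t_i}(u_i,A)>0$ for $i=1,2$. Asymptotically strong Feller: a pseudo-metric on $\mathcal X$ is a continuous symmetric function $d:\mathcal X^2\to\mathbf R_+$ with $d(x,x)=0$ satisfying the triangle inequality. An increasing sequence $(d_n)$ of pseudo-metrics is totally separating if $\lim_{n\to\infty}d_n(x,y)=1$ for all $x\neq y$. For a pseudo-metric $d$ and probability measures $\mu,\nu$, let $d(\mu,\nu)=\sup\{\int\phi\,d\mu-\int\phi\,d\nu\}$, the supremum being over (bounded measurable) $\phi:\mathcal X\to\mathbf R$ with $|\phi(x)-\phi(y)|\le d(x,y)$ for all $x,y$. The semigroup is asymptotically strong Feller if for every $x\in\mathcal X$ there exist a totally separating sequence of pseudo-metrics $(d_n)$ and times $t_n>0$ such that $$\inf_{U\ni x\ \text{open}}\ \limsup_{n\to\infty}\ \sup_{y\in U} d_n\big(\mathcal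 P_{t_n}(x,\cdot),\mathcal P_{t_n}(y,\cdot)\big)=0 .$$ *)

theory Defs
  imports "HOL-Probability.Probability"
begin

text \<open>
  The state space is a type of class \<open>polish_space\<close>; of its metric only the induced
  topology and Borel sigma-algebra are used. Times are reals, and only the kernels
  \<open>P t\<close> with \<open>0 \<le> t\<close> are constrained.
\<close>

definition markov_semigroup :: "(real \<Rightarrow> 'a::polish_space \<Rightarrow> 'a measure) \<Rightarrow> bool" where
  "markov_semigroup P \<longleftrightarrow>
     (\<forall>t\<ge>0. P t \<in> borel \<rightarrow>\<^sub>M prob_algebra borel) \<and>
     (\<forall>x. P 0 x = return borel x) \<and>
     (\<forall>s\<ge>0. \<forall>t\<ge>0. \<forall>x. P (s + t) x = P s x \<bind> P t)"

definition transition_op ::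
    "(real \<Rightarrow> 'a::polish_space \<Rightarrow> 'a measure) \<Rightarrow> real \<Rightarrow> ('a \<Rightarrow> real) \<Rightarrow> 'a \<Rightarrow> real" where
  "transition_op P t \<phi> x = (\<integral>y. \<phi> y \<partial>P t x)"

definition invariant_prob ::
    "(real \<Rightarrow> 'a::polish_space \<Rightarrow> 'a measure) \<Rightarrow> 'a measure \<Rightarrow> bool" where
  "invariant_prob P \<mu> \<longleftrightarrow> \<mu> \<in> space (prob_algebra borel) \<and> (\<forall>t\<ge>0. \<mu> \<bind> P t = \<mu>)"

definition feller :: "(real \<Rightarrow> 'a::polish_space \<Rightarrow> 'a measure) \<Rightarrow> bool" where
  "feller P \<longleftrightarrow>
     (\<forall>t\<ge>0. \<forall>\<phi>. continuous_on UNIV \<phi> \<and> bounded (range \<phi>) \<longrightarrow>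
        continuous_on UNIV (transition_op P t \<phi>))"

definition weakly_topologically_irreducible ::
    "(real \<Rightarrow> 'a::polish_space \<Rightarrow> 'a measure) \<Rightarrow> bool" where
  "weakly_topologically_irreducible P \<longleftrightarrow>
     (\<forall>u1 u2. \<exists>v. \<forall>A. open A \<and> v \<in> A \<longrightarrow>
        (\<exists>t1>0. \<exists>t2>0. emeasure (P t1 u1) A > 0 \<and> emeasure (P t2 u2) A > 0))"

definition pseudo_metric :: "('a::polish_space \<Rightarrow> 'a \<Rightarrow> real) \<Rightarrow> bool" where
  "pseudo_metric d \<longleftrightarrow>
     continuous_on UNIV (\<lambda>(x, y). d x y) \<and>
     (\<forall>x y. 0 \<le> d x y) \<and>
     (\<forall>x y. d x y = d y x) \<and>
     (\<forall>x. d x x = 0) \<and>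
     (\<forall>x y z. d x z \<le> d x y + d y z)"

definition totally_separating :: "(nat \<Rightarrow> 'a::polish_space \<Rightarrow> 'a \<Rightarrow> real) \<Rightarrow> bool" where
  "totally_separating d \<longleftrightarrow>
     (\<forall>n. pseudo_metric (d n)) \<and>
     (\<forall>x y. incseq (\<lambda>n. d n x y)) \<and>
     (\<forall>x y. x \<noteq> y \<longrightarrow> (\<lambda>n. d n x y) \<longlonglongrightarrow> 1)"

text \<open>
  The supremum is taken in the extended reals: it is infinite when it is unbounded,
  rather than an unspecified real.
\<close>

definition measure_dist ::
    "('a::polish_space \<Rightarrow> 'a \<Rightarrow> real) \<Rightarrow> 'a measure \<Rightarrow> 'a measure \<Rightarrow> ereal" where
  "measure_dist d \<mu> \<nu> =
     (SUP \<phi> \<in> {\<phi> \<in> borel_measurable borel. bounded (range \<phi>) \<and>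
                    (\<forall>x y. \<bar>\<phi> x - \<phi> y\<bar> \<le> d x y)}.
        ereal ((\<integral>x. \<phi> x \<partial>\<mu>) - (\<integral>x. \<phi> x \<partial>\<nu>)))"

definition asymptotically_strong_feller ::
    "(real \<Rightarrow> 'a::polish_space \<Rightarrow> 'a measure) \<Rightarrow> bool" where
  "asymptotically_strong_feller P \<longleftrightarrow>
     (\<forall>x. \<exists>d t. totally_separating d \<and> (\<forall>n. 0 < t n) \<and>
        (INF U \<in> {U. open U \<and> x \<in> U}.
           limsup (\<lambda>n. SUP y \<in> U. measure_dist (d n) (P (t n) x) (P (t n) y))) = 0)"

end

theory Submission
  imports Defs
begin

text \<open>
  Suppose that \<open>\<mu>\<close> and \<open>\<nu>\<close> are different invariant probability measures. The positive and
  the negative part of the signed measure \<open>\<mu> - \<nu>\<close> have the same positive mass. Each of them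
  can only grow under the semigroup, which preserves mass, so both are invariant. Normalised,
  they are two mutually singular invariant probability measures
  (\<open>singular_invariant_probs\<close>). This replaces the passage to ergodic measures.

  Irreducibility and the Feller property force the topological supports of any two invariant
  probability measures to meet: take \<open>u\<^sub>1\<close> and \<open>u\<^sub>2\<close> in the supports, and let \<open>v\<close> be a point
  whose neighbourhoods are charged from both. For an open set \<open>A\<close> the points from which \<open>A\<close>
  is reached at a given time form an open set, so every neighbourhood of \<open>v\<close> has positive
  mass for both invariant measures (\<open>common_support_point\<close>).

  The asymptotic strong Feller property at \<open>v\<close> excludes that two mutually singular invariant
  measures share \<open>v\<close> in their supports (\<open>asymptotically_strong_feller_not_singular\<close>).
  On one hand \<open>d\<^sub>n(\<mu>,\<nu>)\<close> tends to \<open>1\<close>: the measures almost live on disjoint compact sets,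
  on which \<open>d\<^sub>n\<close> tends to \<open>1\<close> uniformly, and the \<open>d\<^sub>n\<close>-distance to one of these
  sets is a test function (\<open>singular_measures_separated\<close>). On the other hand, let \<open>\<phi>\<close> be
  \<open>1\<close>-Lipschitz for \<open>d\<^sub>n\<close>. By invariance \<open>\<phi>\<close> can be replaced by \<open>f = P t \<phi>\<close>, whose
  values lie in an interval of length \<open>1\<close> and which, for large \<open>n\<close>, is nearly constant on
  a fixed neighbourhood \<open>U\<close> of \<open>v\<close>. As both measures charge \<open>U\<close>, the integrals of \<open>f\<close>
  differ by at most a constant smaller than \<open>1\<close>, uniformly in \<open>n\<close>
  (\<open>integral_difference_le_of_local_oscillation\<close>).
\<close>

section \<open>Invariance of the Jordan parts\<close>

text \<open>
  Linearity of the integral in the measure, applied to an identity between signed measures that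
  is written without subtraction because the values are extended reals.
\<close>

lemma nn_integral_balanced_measures:
  assumes sets: "sets M1 = sets M" "sets M2 = sets M" "sets M3 = sets M" "sets M4 = sets M"
    and balance: "\<And>A. A \<in> sets M \<Longrightarrow>
      emeasure M1 A + emeasure M2 A = emeasure M3 A + emeasure M4 A"
    and f: "f \<in> borel_measurable M"
  shows "(\<integral>\<^sup>+x. f x \<partial>M1) + (\<integral>\<^sup>+x. f x \<partial>M2) = (\<integral>\<^sup>+x. f x \<partial>M3) + (\<integral>\<^sup>+x. f x \<partial>M4)"
proof -
  note [simp, measurable_cong] = sets
  note [simp] = sets[THEN sets_eq_imp_space_eq]
  show ?thesis
    using f
  proof (induction rule: borel_measurable_induct)
    case (cong f g)
    have "(\<integral>\<^sup>+x. f x \<partial>N) = (\<integral>\<^sup>+x. g x \<partial>N)" if "space N = space M" for N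
      using cong(3) that by (intro nn_integral_cong) simp
    then show ?case
      using cong(4) by simp
  next
    case (set A)
    then show ?case
      by (simp add: balance)
  next
    case (mult u c)
    then show ?case
      by (simp add: nn_integral_cmult flip: distrib_left)
  next
    case (add u v)
    then show ?case
          proof -
      have split: "(\<integral>\<^sup>+x. v x + u x \<partial>N) = (\<integral>\<^sup>+x. v x \<partial>N) + (\<integral>\<^sup>+x. u x \<partial>N)"
        if "sets N = sets M" for N
        using add.hyps(1,3) that by (intro nn_integral_add) (simp_all cong: measurable_cong_sets)
      have interchange: "(a + b) + (c + d) = (a + c) + (b + d)" for a b c d :: ennreal
        by (simp add: ac_simps)
      show ?thesis
        unfolding sets[THEN split] by (metis interchange add.IH)
    qed
  next
    case (seq U)
    have *: "(\<integral>\<^sup>+x. (SUP i. U i) x \<partial>N) = (SUP i. \<integral>\<^sup>+x. U i x \<partial>N)"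
      "incseq (\<lambda>i. \<integral>\<^sup>+x. U i x \<partial>N)" if [measurable_cong]: "sets N = sets M" for N
    proof -
      show "(\<integral>\<^sup>+x. (SUP i. U i) x \<partial>N) = (SUP i. \<integral>\<^sup>+x. U i x \<partial>N)"
        using nn_integral_monotone_convergence_SUP[of U N] seq.hyps(1,3)
        by (simp add: image_comp)
      show "incseq (\<lambda>i. \<integral>\<^sup>+x. U i x \<partial>N)"
        using seq.hyps(3) by (auto simp: incseq_def le_fun_def intro!: nn_integral_mono)
    qed
    show ?case
      by (simp add: * seq.IH del: SUP_apply Sup_apply flip: ennreal_SUP_add)
  qed
qed

text \<open>
  When \<open>Y\<close> is the positive side of a Hahn decomposition for \<open>\<mu> - \<nu>\<close>, the measure \<open>M\<close> is the
  positive part of \<open>\<mu> - \<nu>\<close>. It is the difference of the restrictions to \<open>Y\<close>, where \<open>\<nu>\<close> is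
  the smaller measure.
\<close>
lemma measure_of_Hahn_excess:
  assumes fin: "finite_measure \<mu>" "finite_measure \<nu>" and sets_eq: "sets \<nu> = sets \<mu>"
    and Y [measurable]: "Y \<in> sets \<mu>"
    and le: "\<And>X. X \<in> sets \<mu> \<Longrightarrow> X \<subseteq> Y \<Longrightarrow> emeasure \<nu> X \<le> emeasure \<mu> X"
  obtains M where "sets M = sets \<mu>" "emeasure M (space M - Y) = 0"
    "\<And>A. A \<in> sets \<mu> \<Longrightarrow> emeasure M A + emeasure \<nu> (A \<inter> Y) = emeasure \<mu> (A \<inter> Y)"
proof -
  interpret \<mu>: finite_measure \<mu> by fact
  interpret \<nu>: finite_measure \<nu> by fact
  note [measurable_cong] = sets_eq
  note sp = sets_eq_imp_space_eq[OF sets_eq]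
  define M where "M = diff_measure (density \<mu> (indicator Y)) (density \<nu> (indicator Y))"
  have dens: "emeasure (density \<mu> (indicator Y)) A = emeasure \<mu> (A \<inter> Y)"
    "emeasure (density \<nu> (indicator Y)) A = emeasure \<nu> (A \<inter> Y)" if "A \<in> sets \<mu>" for A
    using emeasure_restricted[of Y \<mu> A] emeasure_restricted[of Y \<nu> A] that Y sets_eq
    by (simp_all add: Int_commute)
  have M: "emeasure M A = emeasure \<mu> (A \<inter> Y) - emeasure \<nu> (A \<inter> Y)" if A: "A \<in> sets \<mu>" for A
  proof -
    have "finite_measure (density \<mu> (indicator Y))" "finite_measure (density \<nu> (indicator Y))"
      using dens[OF sets.top] sp by (auto intro!: finite_measureI)
    then have "emeasure M A = emeasure (density \<mu> (indicator Y)) A - emeasure (density \<nu> (indicator Y)) A"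
      unfolding M_def
    proof (rule emeasure_diff_measure)
      fix B assume "B \<in> sets (density \<mu> (indicator Y))"
      then have B: "B \<in> sets \<mu>" by simp
      have "emeasure \<nu> (B \<inter> Y) \<le> emeasure \<mu> (B \<inter> Y)"
        using B Y by (intro le) auto
      then show "emeasure (density \<nu> (indicator Y)) B \<le> emeasure (density \<mu> (indicator Y)) B"
        by (simp only: dens[OF B])
    qed (simp_all add: A sets_eq)
    then show ?thesis
      by (simp only: dens[OF A])
  qed
  show thesis
  proof
    show "sets M = sets \<mu>" by (simp add: M_def)
    have "space M = space \<mu>" by (simp add: M_def)
    moreover have "(space \<mu> - Y) \<inter> Y = {}" by blast
    ultimately show "emeasure M (space M - Y) = 0"
      using M[of "space \<mu> - Y"] by simp
    show "emeasure M A + emeasure \<nu> (A \<inter> Y) = emeasure \<mu> (A \<inter> Y)" if "A \<in> sets \<mu>" for A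
      using that by (simp add: M le diff_add_cancel_ennreal)
  qed
qed

text \<open>
  \<open>M\<close> and \<open>M'\<close> are the Jordan parts of \<open>\<mu> - \<nu>\<close>. On a set \<open>C \<subseteq> Y\<close> the measure \<open>M\<close> coincides
  with the signed measure \<open>\<mu> - \<nu>\<close>, which is invariant, and \<open>\<mu> - \<nu> \<le> M\<close> everywhere.
  Hence one step of the kernel \<open>P t\<close> can only increase \<open>M\<close>. It also preserves the total mass,
  so it leaves \<open>M\<close> unchanged.
\<close>
lemma invariant_singular_part:
  assumes inv: "invariant_prob P \<mu>" "invariant_prob P \<nu>"
    and P: "\<And>t. 0 \<le> t \<Longrightarrow> P t \<in> borel \<rightarrow>\<^sub>M prob_algebra borel"
    and sets: "sets M = sets borel" "sets M' = sets borel"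
    and balance: "\<And>A. A \<in> sets borel \<Longrightarrow>
      emeasure M A + emeasure \<nu> A = emeasure M' A + emeasure \<mu> A"
    and Y: "Y \<in> sets borel" "emeasure M (- Y) = 0" "emeasure M' Y = 0"
    and fin: "emeasure M UNIV \<noteq> \<infinity>"
    and t: "0 \<le> t" and A: "A \<in> sets borel"
  shows "(\<integral>\<^sup>+x. emeasure (P t x) A \<partial>M) = emeasure M A"
proof -
  have \<mu>: "\<mu> \<in> space (prob_algebra borel)" "\<nu> \<in> space (prob_algebra borel)"
    using inv by (auto simp: invariant_prob_def)
  then have [simp]: "sets \<mu> = sets borel" "sets \<nu> = sets borel"
    and "prob_space \<nu>"
    by (auto simp: space_prob_algebra)
  interpret \<nu>: prob_space \<nu> by fact
  have Pt: "P t \<in> borel \<rightarrow>\<^sub>M prob_algebra borel" using P t by blast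
  then have Pprob: "prob_space (P t x)" "sets (P t x) = sets borel" "space (P t x) = UNIV" for x
    using measurable_space[OF Pt, of x] by (auto simp: space_prob_algebra dest: sets_eq_imp_space_eq)
  have meas [measurable]: "(\<lambda>x. emeasure (P t x) B) \<in> borel_measurable borel"
    if "B \<in> sets borel" for B
    using measurable_prob_algebraD[OF Pt] that by measurable
  have invB: "(\<integral>\<^sup>+x. emeasure (P t x) B \<partial>\<mu>) = emeasure \<mu> B"
    "(\<integral>\<^sup>+x. emeasure (P t x) B \<partial>\<nu>) = emeasure \<nu> B" if "B \<in> sets borel" for B
    using emeasure_bind_prob_algebra[OF \<mu>(1) Pt that] emeasure_bind_prob_algebra[OF \<mu>(2) Pt that] inv t
    by (auto simp: invariant_prob_def)
  have grow: "emeasure M B \<le> (\<integral>\<^sup>+x. emeasure (P t x) B \<partial>M)" if B: "B \<in> sets borel" for B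
  proof -
    let ?C = "B \<inter> Y"
    have C: "?C \<in> sets borel" using B Y by simp
    have M'C: "emeasure M' ?C = 0"
      using emeasure_mono[of ?C Y M'] Y sets by simp
    have "emeasure M B \<le> emeasure M (?C \<union> - Y)"
      using B Y sets by (intro emeasure_mono) auto
    also have "\<dots> \<le> emeasure M ?C + emeasure M (- Y)"
      using B Y sets by (intro emeasure_subadditive) auto
    finally have *: "emeasure M B \<le> emeasure M ?C" using Y by simp
    have "emeasure \<nu> ?C + emeasure M ?C = emeasure \<mu> ?C"
      using balance[OF C] M'C by (simp add: add.commute)
    also have "\<dots> \<le> (\<integral>\<^sup>+x. emeasure (P t x) ?C \<partial>M') + (\<integral>\<^sup>+x. emeasure (P t x) ?C \<partial>\<mu>)"
      by (simp add: invB C)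
    also have "\<dots> = (\<integral>\<^sup>+x. emeasure (P t x) ?C \<partial>M) + (\<integral>\<^sup>+x. emeasure (P t x) ?C \<partial>\<nu>)"
      using balance meas[OF C] sets
      by (intro nn_integral_balanced_measures[where M=borel, symmetric]) auto
    also have "\<dots> = emeasure \<nu> ?C + (\<integral>\<^sup>+x. emeasure (P t x) ?C \<partial>M)"
      by (simp add: invB C add.commute)
    finally have "emeasure M ?C \<le> (\<integral>\<^sup>+x. emeasure (P t x) ?C \<partial>M)"
      using ennreal_add_left_cancel_le[of "emeasure \<nu> ?C"] by (simp add: \<nu>.emeasure_eq_measure)
    also have "\<dots> \<le> (\<integral>\<^sup>+x. emeasure (P t x) B \<partial>M)"
      using B by (intro nn_integral_mono emeasure_mono) (auto simp: Pprob)
    finally show ?thesis using * by simp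
  qed
  show ?thesis
  proof (rule antisym)
    \<comment> \<open>Growth on the complement of \<open>A\<close> and conservation of mass bound the mass on \<open>A\<close> from above.\<close>
    have "emeasure M A + emeasure M (- A) = emeasure M UNIV"
      using A sets by (subst plus_emeasure) auto
    also have "\<dots> = (\<integral>\<^sup>+x. emeasure (P t x) A + emeasure (P t x) (- A) \<partial>M)"
    proof -
      have "emeasure (P t x) A + emeasure (P t x) (- A) = 1" for x
        using A prob_space.emeasure_space_1[OF Pprob(1)] by (subst plus_emeasure) (auto simp: Pprob)
      then show ?thesis using sets_eq_imp_space_eq[OF sets(1)] by simp
    qed
    also have "\<dots> = (\<integral>\<^sup>+x. emeasure (P t x) A \<partial>M) + (\<integral>\<^sup>+x. emeasure (P t x) (- A) \<partial>M)"
      using A sets by (intro nn_integral_add) (auto cong: measurable_cong_sets)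
    also have "\<dots> \<ge> (\<integral>\<^sup>+x. emeasure (P t x) A \<partial>M) + emeasure M (- A)"
      using A by (intro add_left_mono grow) auto
    finally have "emeasure M (- A) + (\<integral>\<^sup>+x. emeasure (P t x) A \<partial>M) \<le> emeasure M (- A) + emeasure M A"
      by (simp add: add.commute)
    moreover have "emeasure M (- A) \<noteq> \<infinity>"
      using fin emeasure_mono[OF subset_UNIV, of M "- A"] sets by (auto simp: top_unique)
    ultimately show "(\<integral>\<^sup>+x. emeasure (P t x) A \<partial>M) \<le> emeasure M A"
      using ennreal_add_left_cancel_le[of "emeasure M (- A)"] by simp
  qed (rule grow[OF A])
qed

lemma normalised_invariant_measure:
  assumes P: "\<And>t. 0 \<le> t \<Longrightarrow> P t \<in> borel \<rightarrow>\<^sub>M prob_algebra borel"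
    and M: "sets M = sets borel" "emeasure M UNIV \<noteq> 0" "emeasure M UNIV \<noteq> \<infinity>"
    and inv: "\<And>t A. 0 \<le> t \<Longrightarrow> A \<in> sets borel \<Longrightarrow> (\<integral>\<^sup>+x. emeasure (P t x) A \<partial>M) = emeasure M A"
  shows "invariant_prob P (scale_measure (1 / emeasure M UNIV) M)" (is "invariant_prob P ?N")
proof -
  have sp: "space M = UNIV" using sets_eq_imp_space_eq[OF M(1)] by simp
  have "emeasure ?N UNIV = 1"
    using M by (simp add: ennreal_divide_times ennreal_divide_self top.not_eq_extremum)
  then have N: "?N \<in> space (prob_algebra borel)"
    using M by (auto simp: space_prob_algebra sp space_scale_measure intro!: prob_spaceI)
  have "?N \<bind> P t = ?N" if t: "0 \<le> t" for t
  proof (rule measure_eqI)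
    show "sets (?N \<bind> P t) = sets ?N"
      using sets_bind'[OF N P[OF t]] M by simp
    fix A assume "A \<in> sets (?N \<bind> P t)"
    then have A: "A \<in> sets borel" using sets_bind'[OF N P[OF t]] by simp
    have "(\<lambda>x. emeasure (P t x) A) \<in> borel_measurable M"
      using measurable_prob_algebraD[OF P[OF t]] A M(1) by (auto cong: measurable_cong_sets)
    then show "emeasure (?N \<bind> P t) A = emeasure ?N A"
      using emeasure_bind_prob_algebra[OF N P[OF t] A] inv[OF t A]
      by (simp add: nn_integral_scale_measure)
  qed
  with N show ?thesis by (simp add: invariant_prob_def)
qed

text \<open>
  The two measures are the normalised Jordan parts of \<open>\<mu> - \<nu>\<close>. The lemma on invariance of
  a Jordan part is applied twice, the second time to \<open>\<nu> - \<mu>\<close> and the complement of \<open>Y\<close>.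
\<close>
lemma singular_invariant_probs:
  assumes P: "\<And>t. 0 \<le> t \<Longrightarrow> P t \<in> borel \<rightarrow>\<^sub>M prob_algebra borel"
    and inv: "invariant_prob P \<mu>" "invariant_prob P \<nu>" and neq: "\<mu> \<noteq> \<nu>"
  obtains \<mu>' \<nu>' Y where "invariant_prob P \<mu>'" "invariant_prob P \<nu>'" "Y \<in> sets borel"
    "emeasure \<mu>' (- Y) = 0" "emeasure \<nu>' Y = 0"
proof -
  have \<mu>: "sets \<mu> = sets borel" "sets \<nu> = sets borel" "prob_space \<mu>" "prob_space \<nu>"
    using inv by (auto simp: invariant_prob_def space_prob_algebra)
  interpret \<mu>: prob_space \<mu> by fact
  interpret \<nu>: prob_space \<nu> by fact
  have sp: "space \<mu> = UNIV" "space \<nu> = UNIV" using \<mu>(1,2)[THEN sets_eq_imp_space_eq] by auto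
  obtain Y where Y: "Y \<in> sets borel"
    and le: "\<And>X. X \<in> sets borel \<Longrightarrow> X \<subseteq> Y \<Longrightarrow> emeasure \<nu> X \<le> emeasure \<mu> X"
    and ge: "\<And>X. X \<in> sets borel \<Longrightarrow> X \<inter> Y = {} \<Longrightarrow> emeasure \<mu> X \<le> emeasure \<nu> X"
    using finite_unsigned_Hahn_decomposition[of \<mu> \<nu>] \<mu>
    by (auto simp: \<mu>.finite_measure_axioms \<nu>.finite_measure_axioms)
  obtain M where M: "sets M = sets borel" "emeasure M (- Y) = 0"
    "\<And>A. A \<in> sets borel \<Longrightarrow> emeasure M A + emeasure \<nu> (A \<inter> Y) = emeasure \<mu> (A \<inter> Y)"
    using measure_of_Hahn_excess[OF \<mu>.finite_measure_axioms \<nu>.finite_measure_axioms, of Y]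
      Y le \<mu> by (metis Compl_eq_Diff_UNIV sets_eq_imp_space_eq space_borel)
  obtain M' where M': "sets M' = sets borel" "emeasure M' Y = 0"
    "\<And>A. A \<in> sets borel \<Longrightarrow> emeasure M' A + emeasure \<mu> (A \<inter> - Y) = emeasure \<nu> (A \<inter> - Y)"
    using measure_of_Hahn_excess[OF \<nu>.finite_measure_axioms \<mu>.finite_measure_axioms, of "- Y"]
      Y ge \<mu> by (metis Compl_disjoint2 Compl_eq_Diff_UNIV disjoint_eq_subset_Compl double_compl borel_comp sets_eq_imp_space_eq space_borel)
  have split: "emeasure N A = emeasure N (A \<inter> Y) + emeasure N (A \<inter> - Y)"
    if "A \<in> sets borel" "sets N = sets borel" for N A
    using that Y by (subst plus_emeasure) (auto simp: Int_Un_distrib[symmetric])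
  have balance: "emeasure M A + emeasure \<nu> A = emeasure M' A + emeasure \<mu> A"
    if A: "A \<in> sets borel" for A
  proof -
    have "emeasure M A + emeasure \<nu> A
        = (emeasure M A + emeasure \<nu> (A \<inter> Y)) + emeasure \<nu> (A \<inter> - Y)"
      using split[OF A \<mu>(2)] by (simp add: add.assoc)
    also have "\<dots> = emeasure \<mu> (A \<inter> Y) + (emeasure M' A + emeasure \<mu> (A \<inter> - Y))"
      using M(3)[OF A] M'(3)[OF A] by simp
    also have "\<dots> = emeasure M' A + emeasure \<mu> A"
      using split[OF A \<mu>(1)] by (simp add: add_ac)
    finally show ?thesis .
  qed
  have "emeasure M UNIV \<le> emeasure M UNIV + emeasure \<nu> (UNIV \<inter> Y)" by simp
  also have "\<dots> = emeasure \<mu> (UNIV \<inter> Y)" by (rule M(3)) simp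
  finally have finM: "emeasure M UNIV \<noteq> \<infinity>"
    by (metis \<mu>.emeasure_finite infinity_ennreal_def top.extremum_unique)
  have "1 + emeasure M UNIV = 1 + emeasure M' UNIV"
    using balance[of UNIV] \<mu>.emeasure_space_1 \<nu>.emeasure_space_1 sp by (simp add: add.commute)
  then have mass: "emeasure M UNIV = emeasure M' UNIV"
    using ennreal_add_left_cancel[of 1] by simp
  have pos: "emeasure M UNIV \<noteq> 0"
  proof
    assume 0: "emeasure M UNIV = 0"
    have "emeasure M A = 0" "emeasure M' A = 0" if "A \<in> sets borel" for A
      using 0 mass emeasure_mono[OF subset_UNIV, of M A] emeasure_mono[OF subset_UNIV, of M' A]
        M(1) M'(1) by simp_all
    then have "\<mu> = \<nu>"
      using balance \<mu>(1,2) by (intro measure_eqI) simp_all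
    with neq show False ..
  qed
  have "invariant_prob P (scale_measure (1 / emeasure M UNIV) M)"
    using invariant_singular_part[OF inv P M(1) M'(1) balance Y M(2) M'(2) finM]
    by (intro normalised_invariant_measure[OF P M(1) pos finM])
  moreover have "invariant_prob P (scale_measure (1 / emeasure M' UNIV) M')"
  proof (rule normalised_invariant_measure[OF P M'(1)])
    show "(\<integral>\<^sup>+x. emeasure (P t x) A \<partial>M') = emeasure M' A" if "0 \<le> t" "A \<in> sets borel" for t A
      using Y M(2) M'(2) finM mass that
      by (intro invariant_singular_part[OF inv(2,1) P M'(1) M(1) balance[symmetric], where Y = "- Y"])
        simp_all
  qed (use pos finM mass in simp_all)
  ultimately show thesis
    using that Y M(2) M'(2) by simp
qed

section \<open>Supports of invariant measures\<close>

text \<open>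
  If no point were in the support, countably many null basic open sets would cover the space.
\<close>
lemma open_support_point:
  fixes \<mu> :: "'a::second_countable_topology measure"
  assumes sets: "sets \<mu> = sets borel" and nz: "emeasure \<mu> UNIV \<noteq> 0"
  obtains u where "\<And>U. open U \<Longrightarrow> u \<in> U \<Longrightarrow> emeasure \<mu> U > 0"
proof -
  obtain B :: "'a set set" where B: "countable B" "topological_basis B"
    using ex_countable_basis by blast
  have "\<exists>u. \<forall>U. open U \<and> u \<in> U \<longrightarrow> emeasure \<mu> U > 0"
  proof (rule ccontr)
    assume "\<not> ?thesis"
    then have null: "\<exists>U. open U \<and> u \<in> U \<and> emeasure \<mu> U = 0" for u
      by (meson not_gr_zero)
    let ?N = "{V \<in> B. emeasure \<mu> V = 0}"
    have "u \<in> \<Union>?N" for u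
    proof -
      obtain U where U: "open U" "u \<in> U" "emeasure \<mu> U = 0" using null by blast
      obtain V where V: "V \<in> B" "u \<in> V" "V \<subseteq> U"
        using topological_basisE[OF B(2) U(1,2)] by blast
      have "emeasure \<mu> V = 0"
        using emeasure_mono[OF V(3), of \<mu>] U sets by simp
      with V show ?thesis by blast
    qed
    then have "\<Union>?N = UNIV" by blast
    moreover have "(\<Union>V\<in>?N. V) \<in> null_sets \<mu>"
    proof (rule null_sets_UN')
      show "countable ?N" using B(1) by simp
      show "V \<in> null_sets \<mu>" if "V \<in> ?N" for V
        using that topological_basis_open[OF B(2)] sets by auto
    qed
    ultimately have "emeasure \<mu> UNIV = 0" by auto
    with nz show False ..
  qed
  with that show thesis by blast
qed

text \<open>
  The indicator of \<open>A\<close> is not continuous, but the truncated distance to the complement of \<open>A\<close>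
  is bounded, continuous and positive exactly on \<open>A\<close>. Its integral against \<open>P t u\<close> is thus
  positive exactly when \<open>A\<close> is reached from \<open>u\<close>, and is continuous in \<open>u\<close> by the Feller property.
\<close>
lemma open_reaching_set:
  assumes P: "markov_semigroup P" and feller: "feller P" and t: "0 \<le> t" and A: "open A"
  shows "open {u. emeasure (P t u) A > 0}"
proof -
  have "P t \<in> borel \<rightarrow>\<^sub>M prob_algebra borel" using P t by (auto simp: markov_semigroup_def)
  then have Pprob: "prob_space (P t x)" "sets (P t x) = sets borel" "space (P t x) = UNIV" for x
    using measurable_space[of "P t" borel "prob_algebra borel" x]
    by (auto simp: space_prob_algebra dest: sets_eq_imp_space_eq)
  show ?thesis
  proof (cases "A = UNIV")
    case True
    then show ?thesis
      using prob_space.emeasure_space_1[OF Pprob(1)] Pprob(3) by simp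
  next
    case False
    \<comment> \<open>The distance to the empty set is \<open>0\<close> by convention, hence the separate case \<open>A = UNIV\<close>.\<close>
    define \<phi> where "\<phi> x = min 1 (infdist x (- A))" for x
    have \<phi>: "continuous_on UNIV \<phi>" "\<And>x. 0 \<le> \<phi> x" "\<And>x. \<phi> x \<le> 1"
      unfolding \<phi>_def by (auto intro!: continuous_intros simp: infdist_nonneg)
    have \<phi>0: "\<phi> x = 0 \<longleftrightarrow> x \<notin> A" for x
    proof -
      have "infdist x (- A) = 0 \<longleftrightarrow> x \<notin> A"
        using in_closed_iff_infdist_zero[of "- A" x] A False by (auto simp: closed_Compl)
      then show ?thesis by (auto simp: \<phi>_def min_def)
    qed
    have meas: "\<phi> \<in> borel_measurable (P t x)" for x
      using borel_measurable_continuous_onI[OF \<phi>(1)] Pprob(2)[of x] by (simp cong: measurable_cong_sets)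
    have "emeasure (P t u) A > 0 \<longleftrightarrow> transition_op P t \<phi> u > 0" for u
    proof -
      interpret prob_space "P t u" by (rule Pprob)
      have int: "integrable (P t u) \<phi>"
        using \<phi> meas by (intro integrable_const_bound[of _ 1]) auto
      have "(\<integral>y. \<phi> y \<partial>P t u) = 0 \<longleftrightarrow> (AE y in P t u. y \<notin> A)"
        using integral_nonneg_eq_0_iff_AE[OF int] \<phi> \<phi>0 by simp
      also have "\<dots> \<longleftrightarrow> emeasure (P t u) A = 0"
        using A Pprob by (subst AE_iff_measurable[of A]) auto
      finally show ?thesis
        using Bochner_Integration.integral_nonneg[of "P t u" \<phi>] \<phi>(2)
        by (simp add: transition_op_def zero_less_iff_neq_zero less_le)
    qed
    moreover have "open {u. transition_op P t \<phi> u > 0}"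
    proof -
      have "bounded (range \<phi>)"
        using \<phi> by (intro boundedI[of _ 1]) auto
      then have "continuous_on UNIV (transition_op P t \<phi>)"
        using feller t \<phi> by (auto simp: feller_def)
      then show ?thesis
        by (intro open_Collect_less) auto
    qed
    ultimately show ?thesis by simp
  qed
qed

text \<open>
  If \<open>u\<close> is in the support of an invariant measure and \<open>A\<close> is reached from \<open>u\<close> at time \<open>t\<close>, then
  \<open>A\<close> is reached from a whole neighbourhood of \<open>u\<close>, which has positive mass; integrating
  \<open>P t x A\<close> over it shows that the invariant measure charges \<open>A\<close>.
\<close>
lemma common_support_point:
  assumes P: "markov_semigroup P" and feller: "feller P" and irr: "weakly_topologically_irreducible P"
    and inv: "invariant_prob P \<mu>" "invariant_prob P \<nu>"
  obtains v where "\<And>A. open A \<Longrightarrow> v \<in> A \<Longrightarrow> emeasure \<mu> A > 0 \<and> emeasure \<nu> A > 0"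
proof -
  have supp: "\<exists>u. \<forall>U. open U \<longrightarrow> u \<in> U \<longrightarrow> emeasure \<rho> U > 0" if "invariant_prob P \<rho>" for \<rho>
  proof -
    have "sets \<rho> = sets borel" "prob_space \<rho>"
      using that by (auto simp: invariant_prob_def space_prob_algebra)
    moreover have "emeasure \<rho> UNIV \<noteq> 0"
      using prob_space.emeasure_space_1[OF calculation(2)] sets_eq_imp_space_eq[OF calculation(1)] by simp
    ultimately show ?thesis using open_support_point[of \<rho>] by metis
  qed
  have pos: "emeasure \<rho> A > 0"
    if \<rho>: "invariant_prob P \<rho>" and u: "\<And>U. open U \<Longrightarrow> u \<in> U \<Longrightarrow> emeasure \<rho> U > 0"
      and t: "0 < t" and A: "open A" and reach: "emeasure (P t u) A > 0" for \<rho> u t A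
  proof -
    have \<rho>1: "\<rho> \<in> space (prob_algebra borel)" "\<rho> \<bind> P t = \<rho>"
      using \<rho> t by (auto simp: invariant_prob_def)
    have sets [measurable_cong]: "sets \<rho> = sets borel" using \<rho>1 by (auto simp: space_prob_algebra)
    have Pt: "P t \<in> borel \<rightarrow>\<^sub>M prob_algebra borel" using P t by (auto simp: markov_semigroup_def)
    have "(\<lambda>x. emeasure (P t x) A) \<in> borel_measurable borel"
      using measurable_prob_algebraD[OF Pt] A by measurable
    then have meas: "(\<lambda>x. emeasure (P t x) A) \<in> borel_measurable \<rho>"
      using sets by (simp cong: measurable_cong_sets)
    have "emeasure \<rho> {x. emeasure (P t x) A > 0} > 0"
      using t A reach by (intro u open_reaching_set[OF P feller]) auto
    moreover have "{x. emeasure (P t x) A > 0} = {x \<in> space \<rho>. emeasure (P t x) A \<noteq> 0}"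
      using sets_eq_imp_space_eq[OF sets] by (auto simp: zero_less_iff_neq_zero)
    ultimately have "(\<integral>\<^sup>+x. emeasure (P t x) A \<partial>\<rho>) \<noteq> 0"
      using nn_integral_0_iff[OF meas] by simp
    then show ?thesis
      using emeasure_bind_prob_algebra[OF \<rho>1(1) Pt, of A] A \<rho>1(2) by (simp add: zero_less_iff_neq_zero)
  qed
  obtain u1 u2 where u1: "\<And>U. open U \<Longrightarrow> u1 \<in> U \<Longrightarrow> emeasure \<mu> U > 0"
    and u2: "\<And>U. open U \<Longrightarrow> u2 \<in> U \<Longrightarrow> emeasure \<nu> U > 0"
    using supp inv by meson
  obtain v where v: "\<And>A. open A \<Longrightarrow> v \<in> A \<Longrightarrow>
      \<exists>t1>0. \<exists>t2>0. emeasure (P t1 u1) A > 0 \<and> emeasure (P t2 u2) A > 0"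
    using irr unfolding weakly_topologically_irreducible_def by meson
  show thesis
  proof
    fix A :: "'a set" assume A: "open A" "v \<in> A"
    obtain t1 t2 where "0 < t1" "emeasure (P t1 u1) A > 0" "0 < t2" "emeasure (P t2 u2) A > 0"
      using v[OF A] by blast
    then show "emeasure \<mu> A > 0 \<and> emeasure \<nu> A > 0"
      using pos[OF inv(1) u1 _ A(1)] pos[OF inv(2) u2 _ A(1)] by simp
  qed
qed

section \<open>Test functions for totally separating pseudo-metrics\<close>

lemma totally_separating_le_1:
  assumes "totally_separating d"
  shows "d n x y \<le> 1"
proof (cases "x = y")
  case True
  then show ?thesis
    using assms by (simp add: totally_separating_def pseudo_metric_def)
next
  case False
  then show ?thesis
    using assms incseq_le[of "\<lambda>n. d n x y" 1 n] by (simp add: totally_separating_def)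
qed

lemma continuous_on_pseudo_metric_Lipschitz:
  assumes d: "pseudo_metric d" and lip: "\<And>x y. \<bar>\<phi> x - \<phi> y\<bar> \<le> d x y"
  shows "continuous_on UNIV \<phi>"
proof -
  have "(\<phi> \<longlongrightarrow> \<phi> x) (at x)" for x
  proof -
    have "continuous_on UNIV (\<lambda>p. d (fst p) (snd p))"
      using d by (simp add: pseudo_metric_def case_prod_beta)
    then have "continuous_on UNIV (\<lambda>y. d (fst (y, x)) (snd (y, x)))"
      by (rule continuous_on_compose2) (auto intro!: continuous_intros)
    then have "((\<lambda>y. d y x) \<longlongrightarrow> d x x) (at x)"
      by (simp add: continuous_on_def)
    moreover have "d x x = 0" using d by (simp add: pseudo_metric_def)
    ultimately have "((\<lambda>y. \<phi> y - \<phi> x) \<longlongrightarrow> 0) (at x)"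
      using lip by (intro Lim_null_comparison[of "\<lambda>y. \<phi> y - \<phi> x" "\<lambda>y. d y x"]) (auto simp: always_eventually)
    then show ?thesis by (simp add: LIM_zero_iff)
  qed
  then show ?thesis by (simp add: continuous_on_def)
qed

text \<open>
  A Dini argument: the open sets on which \<open>d n\<close> exceeds \<open>c\<close> increase with \<open>n\<close> and cover the
  compact product \<open>K \<times> L\<close>, which misses the diagonal.
\<close>
lemma totally_separating_uniform_on_compact:
  assumes d: "totally_separating d" and K: "compact K" "compact L" "K \<inter> L = {}" and c: "c < 1"
  shows "\<forall>\<^sub>F n in sequentially. \<forall>x\<in>K. \<forall>y\<in>L. c < d n x y"
proof -
  let ?U = "\<lambda>n. {p. c < d n (fst p) (snd p)}"
  have opn: "open (?U n)" for n
  proof -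
    have "continuous_on UNIV (\<lambda>p. d n (fst p) (snd p))"
      using d by (auto simp: totally_separating_def pseudo_metric_def case_prod_beta)
    then show ?thesis by (intro open_Collect_less) auto
  qed
  have mono: "?U m \<subseteq> ?U n" if "m \<le> n" for m n
  proof
    fix p assume "p \<in> ?U m"
    moreover have "d m (fst p) (snd p) \<le> d n (fst p) (snd p)"
      using d that by (auto simp: totally_separating_def incseq_def)
    ultimately show "p \<in> ?U n" by simp
  qed
  have "K \<times> L \<subseteq> (\<Union>n. ?U n)"
  proof
    fix p assume p: "p \<in> K \<times> L"
    with K have "fst p \<noteq> snd p" by auto
    then have "(\<lambda>n. d n (fst p) (snd p)) \<longlonglongrightarrow> 1"
      using d by (auto simp: totally_separating_def)
    from order_tendstoD(1)[OF this c] show "p \<in> (\<Union>n. ?U n)"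
      by (auto simp: eventually_sequentially)
  qed
  from compactE_image[OF compact_Times[OF K(1,2)] opn this]
  obtain T where T: "finite T" "K \<times> L \<subseteq> (\<Union>n\<in>T. ?U n)" .
  have "\<forall>x\<in>K. \<forall>y\<in>L. c < d n x y" if n: "Max (insert 0 T) \<le> n" for n
  proof (intro ballI)
    fix x y assume "x \<in> K" "y \<in> L"
    then obtain m where "m \<in> T" "(x, y) \<in> ?U m" using T by blast
    moreover have "m \<le> n" using n T \<open>m \<in> T\<close> by simp
    ultimately have "(x, y) \<in> ?U n" using mono by blast
    then show "c < d n x y" by simp
  qed
  then show ?thesis unfolding eventually_sequentially by (intro exI allI impI)
qed

lemma pseudo_distance_to_set_Lipschitz:
  assumes d: "pseudo_metric d" and L: "L \<noteq> {}"
  shows "\<bar>(INF z\<in>L. d x z) - (INF z\<in>L. d y z)\<bar> \<le> d x y"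
proof -
  have bdd: "bdd_below ((\<lambda>z. d w z) ` L)" for w
    using d by (intro bdd_belowI[of _ 0]) (auto simp: pseudo_metric_def)
  have "(INF z\<in>L. d x z) \<le> d x y + (INF z\<in>L. d y z)" for x y
  proof -
    have "(INF z\<in>L. d x z) - d x y \<le> (INF z\<in>L. d y z)"
    proof (rule cINF_greatest[OF L])
      fix z assume "z \<in> L"
      then have "(INF z\<in>L. d x z) \<le> d x z" by (rule cINF_lower[OF bdd])
      also have "\<dots> \<le> d x y + d y z" using d by (auto simp: pseudo_metric_def)
      finally show "(INF z\<in>L. d x z) - d x y \<le> d y z" by simp
    qed
    then show ?thesis by simp
  qed
  from this[of x y] this[of y x] show ?thesis
    using d by (auto simp: pseudo_metric_def abs_le_iff)
qed

text \<open>
  By inner regularity there are disjoint compact sets \<open>K\<close> and \<open>L\<close> that carry nearly all the mass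
  of \<open>\<mu>\<close> and of \<open>\<nu>\<close>. For large \<open>n\<close> the function that maps \<open>x\<close> to its \<open>d n\<close>-distance to \<open>L\<close>
  vanishes on \<open>L\<close>, is nearly \<open>1\<close> on \<open>K\<close>, and lies between \<open>0\<close> and \<open>1\<close>.
\<close>
lemma singular_measures_separated:
  fixes \<mu> \<nu> :: "'a::polish_space measure"
  assumes d: "totally_separating d"
    and \<mu>: "prob_space \<mu>" "sets \<mu> = sets borel" and \<nu>: "prob_space \<nu>" "sets \<nu> = sets borel"
    and Y: "Y \<in> sets borel" "emeasure \<mu> (- Y) = 0" "emeasure \<nu> Y = 0" and c: "c < 1"
  shows "\<forall>\<^sub>F n in sequentially. \<exists>\<phi>. (\<forall>x y. \<bar>\<phi> x - \<phi> y\<bar> \<le> d n x y) \<and>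
    c < (\<integral>x. \<phi> x \<partial>\<mu>) - (\<integral>x. \<phi> x \<partial>\<nu>)"
proof -
  interpret \<mu>: prob_space \<mu> by fact
  interpret \<nu>: prob_space \<nu> by fact
  have sp: "space \<mu> = UNIV" "space \<nu> = UNIV"
    using \<mu>(2) \<nu>(2) by (auto dest: sets_eq_imp_space_eq)
  \<comment> \<open>The test function below separates the integrals by at least \<open>(1 - e)\<^sup>2 - e > 1 - 3 * e\<close>.\<close>
  define e where "e = min (1/2) ((1 - c) / 4)"
  have e: "0 < e" "e < 1" "3 * e < 1 - c" using c by (auto simp: e_def min_def)
  have tight: "\<exists>K\<subseteq>B. compact K \<and> 1 - e < measure M K"
    if M: "prob_space M" "sets M = sets borel" and B: "B \<in> sets borel" "emeasure M (- B) = 0"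
    for M and B :: "'a set"
  proof -
    interpret prob_space M by fact
    have spM: "space M = UNIV" using sets_eq_imp_space_eq[OF M(2)] by simp
    have "prob (- B) = 0" using B by (simp add: measure_def)
    then have "emeasure M B = 1"
      using prob_compl[of B] B M spM by (simp add: Compl_eq_Diff_UNIV emeasure_eq_measure)
    then have "ennreal (1 - e) < (SUP K\<in>{K. K \<subseteq> B \<and> compact K}. emeasure M K)"
      using inner_regular[OF M(2) _ B(1)] e by (simp add: ennreal_less_one_iff)
    then obtain K where "K \<subseteq> B" "compact K" "ennreal (1 - e) < emeasure M K"
      by (auto simp: less_SUP_iff)
    then show ?thesis
      using e by (auto simp: emeasure_eq_measure ennreal_less_iff)
  qed
  obtain K where K: "K \<subseteq> Y" "compact K" "1 - e < measure \<mu> K"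
    using tight[OF \<mu>, of Y] Y by auto
  obtain L where L: "L \<subseteq> - Y" "compact L" "1 - e < measure \<nu> L"
    using tight[OF \<nu>, of "- Y"] Y by auto
  have L0: "L \<noteq> {}" using L e by auto
  have KL: "K \<in> sets borel" "L \<in> sets borel" using K L by (auto intro: borel_compact)
  have "\<forall>\<^sub>F n in sequentially. \<forall>x\<in>K. \<forall>y\<in>L. 1 - e < d n x y"
    using K L e by (intro totally_separating_uniform_on_compact[OF d]) auto
  then show ?thesis
  proof eventually_elim
    case (elim n)
    have dn: "pseudo_metric (d n)" using d by (simp add: totally_separating_def)
    have nn: "0 \<le> d n x y" for x y using dn by (simp add: pseudo_metric_def)
    define \<phi> where "\<phi> x = (INF z\<in>L. d n x z)" for x
    have lip: "\<bar>\<phi> x - \<phi> y\<bar> \<le> d n x y" for x y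
      unfolding \<phi>_def by (rule pseudo_distance_to_set_Lipschitz[OF dn L0])
    have bdd: "bdd_below ((\<lambda>z. d n w z) ` L)" for w
      using nn by (intro bdd_belowI[of _ 0]) auto
    have ge0: "0 \<le> \<phi> x" for x
      unfolding \<phi>_def using nn by (intro cINF_greatest[OF L0])
    have le1: "\<phi> x \<le> 1" for x
    proof -
      obtain z where "z \<in> L" using L0 by blast
      then have "\<phi> x \<le> d n x z" unfolding \<phi>_def by (rule cINF_lower[OF bdd])
      then show ?thesis using totally_separating_le_1[OF d, of n x z] by simp
    qed
    have \<phi>K: "1 - e \<le> \<phi> x" if "x \<in> K" for x
      unfolding \<phi>_def using elim that by (intro cINF_greatest[OF L0]) (auto intro: less_imp_le)
    have \<phi>L: "\<phi> x = 0" if "x \<in> L" for x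
    proof -
      have "\<phi> x \<le> d n x x" unfolding \<phi>_def using that by (rule cINF_lower[OF bdd])
      then show ?thesis using ge0[of x] dn by (simp add: pseudo_metric_def)
    qed
    have "\<phi> \<in> borel_measurable borel"
      using continuous_on_pseudo_metric_Lipschitz[OF dn lip] by (rule borel_measurable_continuous_onI)
    then have meas: "\<phi> \<in> borel_measurable \<mu>" "\<phi> \<in> borel_measurable \<nu>"
      using \<mu> \<nu> by (simp_all cong: measurable_cong_sets)
    have int: "integrable \<mu> \<phi>" "integrable \<nu> \<phi>"
      using ge0 le1 meas by (auto intro!: \<mu>.integrable_const_bound[of _ 1] \<nu>.integrable_const_bound[of _ 1])
    have "(1 - e) * (1 - e) \<le> (1 - e) * measure \<mu> K"
      using K e by (intro mult_left_mono) auto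
    also have "\<dots> = (\<integral>x. (1 - e) * indicator K x \<partial>\<mu>)"
      using KL \<mu> sp by simp
    also have "\<dots> \<le> (\<integral>x. \<phi> x \<partial>\<mu>)"
    proof (rule integral_mono)
      show "integrable \<mu> (\<lambda>x. (1 - e) * indicator K x)"
        using KL \<mu> by (simp add: \<mu>.emeasure_eq_measure)
    qed (use int \<phi>K ge0 in \<open>auto simp: indicator_def\<close>)
    finally have low: "(1 - e) * (1 - e) \<le> (\<integral>x. \<phi> x \<partial>\<mu>)" .
    have "(\<integral>x. \<phi> x \<partial>\<nu>) \<le> (\<integral>x. indicator (- L) x \<partial>\<nu>)"
    proof (rule integral_mono)
      show "integrable \<nu> (indicator (- L) :: _ \<Rightarrow> real)"
        using KL \<nu> by (simp add: \<nu>.emeasure_eq_measure borel_comp)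
    qed (use int \<phi>L le1 in \<open>auto simp: indicator_def\<close>)
    also have "\<dots> = 1 - measure \<nu> L"
      using KL \<nu> sp \<nu>.prob_compl[of L] by (simp add: Compl_eq_Diff_UNIV)
    finally have "(\<integral>x. \<phi> x \<partial>\<nu>) \<le> e" using L by simp
    with low have "(1 - e) * (1 - e) - e \<le> (\<integral>x. \<phi> x \<partial>\<mu>) - (\<integral>x. \<phi> x \<partial>\<nu>)" by simp
    moreover have "c < (1 - e) * (1 - e) - e"
    proof -
      have "0 < e * e" using e by simp
      then have "1 - 3 * e < (1 - e) * (1 - e) - e" by (simp add: algebra_simps)
      with e show ?thesis by linarith
    qed
    ultimately show ?case using lip by (intro exI[of _ \<phi>]) auto
  qed
qed

section \<open>The contradiction at a common support point\<close>

lemma invariant_integral_transition: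
  fixes \<phi> :: "'a::polish_space \<Rightarrow> real"
  assumes Pt: "P t \<in> borel \<rightarrow>\<^sub>M prob_algebra borel" and t: "0 \<le> t"
    and inv: "invariant_prob P \<mu>"
    and \<phi>: "\<phi> \<in> borel_measurable borel" and bound: "\<And>x. \<bar>\<phi> x\<bar> \<le> B"
  shows "(\<integral>x. transition_op P t \<phi> x \<partial>\<mu>) = (\<integral>x. \<phi> x \<partial>\<mu>)"
proof -
  have \<mu>: "sets \<mu> = sets borel" "prob_space \<mu>" "\<mu> \<bind> P t = \<mu>"
    using inv t by (auto simp: invariant_prob_def space_prob_algebra)
  interpret prob_space \<mu> by fact
  have "P t \<in> \<mu> \<rightarrow>\<^sub>M subprob_algebra borel"
    using measurable_prob_algebraD[OF Pt] \<mu>(1) by (simp cong: measurable_cong_sets)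
  note kernel = this
  have "(\<integral>x. \<phi> x \<partial>(\<mu> \<bind> P t)) = (\<integral>x. transition_op P t \<phi> x \<partial>\<mu>)"
    unfolding transition_op_def
  proof (rule integral_bind[OF \<phi> bound kernel finite_measure_axioms, where B' = 1])
    have "prob_space (P t x)" for x
      using measurable_space[OF Pt, of x] by (simp add: space_prob_algebra)
    then show "AE x in \<mu>. emeasure (P t x) (space (P t x)) \<le> ennreal 1"
      by (simp add: prob_space.emeasure_space_1)
  qed
  then show ?thesis by (simp add: \<mu>(3))
qed

text \<open>
  The values of \<open>f\<close> lie in an interval of length \<open>1\<close>, so the integrals differ by at most \<open>1\<close>.
  The common mass \<open>a\<close> on \<open>A\<close> improves this: there \<open>f\<close> is within \<open>e\<close> of the constant \<open>c\<close>, so this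
  mass contributes at most \<open>2 * e\<close> per unit to the difference.
\<close>
lemma integral_difference_le_of_local_oscillation:
  assumes \<mu>: "prob_space \<mu>" "A \<in> sets \<mu>" and \<nu>: "prob_space \<nu>" "A \<in> sets \<nu>"
    and f: "f \<in> borel_measurable \<mu>" "f \<in> borel_measurable \<nu>"
    and range: "\<And>x. m \<le> f x" "\<And>x. f x \<le> m + 1"
    and local: "\<And>x. x \<in> A \<Longrightarrow> \<bar>f x - c\<bar> \<le> e"
    and a: "a \<le> measure \<mu> A" "a \<le> measure \<nu> A" "0 \<le> a"
  shows "(\<integral>x. f x \<partial>\<mu>) - (\<integral>x. f x \<partial>\<nu>) \<le> 1 - a * (1 - 2 * e)"
proof -
  interpret \<mu>: prob_space \<mu> by fact
  interpret \<nu>: prob_space \<nu> by fact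
  have int: "integrable \<mu> f" "integrable \<nu> f"
    using f range
    by (auto intro!: \<mu>.integrable_const_bound[of _ "\<bar>m\<bar> + 1"] \<nu>.integrable_const_bound[of _ "\<bar>m\<bar> + 1"]
        AE_I2 simp: abs_le_iff)
      (smt (verit))+
  \<comment> \<open>The gaps between \<open>[c - e, c + e]\<close> and the ends of \<open>[m, m + 1]\<close>. Cutting them off at \<open>0\<close>
    lets the masses of \<open>A\<close>, which may differ, be replaced by their common lower bound \<open>a\<close>.\<close>
  let ?p = "max 0 (m + 1 - (c + e))" and ?q = "max 0 (c - e - m)"
  have "(\<integral>x. f x \<partial>\<mu>) \<le> (\<integral>x. (m + 1) - ?p * indicator A x \<partial>\<mu>)"
  proof (rule integral_mono)
    show "f x \<le> (m + 1) - ?p * indicator A x" for x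
      using range[of x] local[of x] by (auto simp: indicator_def abs_le_iff max_def)
  qed (use int \<mu> in \<open>auto simp: \<mu>.emeasure_eq_measure\<close>)
  also have "\<dots> = (m + 1) - ?p * measure \<mu> A"
    using \<mu> by (simp add: \<mu>.emeasure_eq_measure \<mu>.prob_space)
  also have "\<dots> \<le> (m + 1) - ?p * a"
    using a by (intro diff_mono mult_left_mono) auto
  also have "\<dots> \<le> (m + 1) - (m + 1 - (c + e)) * a"
    using a by (intro diff_mono mult_right_mono) auto
  finally have up: "(\<integral>x. f x \<partial>\<mu>) \<le> (m + 1) - (m + 1 - (c + e)) * a" .
  have "m + (c - e - m) * a \<le> m + ?q * a"
    using a by (intro add_mono mult_right_mono) auto
  also have "\<dots> \<le> m + ?q * measure \<nu> A"
    using a by (intro add_mono mult_left_mono) auto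
  also have "\<dots> = (\<integral>x. m + ?q * indicator A x \<partial>\<nu>)"
    using \<nu> by (simp add: \<nu>.emeasure_eq_measure \<nu>.prob_space)
  also have "\<dots> \<le> (\<integral>x. f x \<partial>\<nu>)"
  proof (rule integral_mono)
    show "m + ?q * indicator A x \<le> f x" for x
      using range[of x] local[of x] by (auto simp: indicator_def abs_le_iff max_def)
  qed (use int \<nu> in \<open>auto simp: \<nu>.emeasure_eq_measure\<close>)
  finally have "m + (c - e - m) * a \<le> (\<integral>x. f x \<partial>\<nu>)" .
  with up show ?thesis by (simp add: algebra_simps)
qed

text \<open>
  The supremum bounds only a one-sided difference; the test function \<open>- \<phi>\<close> gives the other side.
\<close>
lemma measure_dist_Lipschitz_bound:
  assumes \<phi>: "\<phi> \<in> borel_measurable borel" "bounded (range \<phi>)"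
    and lip: "\<And>x y. \<bar>\<phi> x - \<phi> y\<bar> \<le> d x y" and less: "measure_dist d \<mu> \<nu> < ereal e"
  shows "\<bar>(\<integral>x. \<phi> x \<partial>\<mu>) - (\<integral>x. \<phi> x \<partial>\<nu>)\<bar> \<le> e"
proof -
  have *: "(\<integral>x. \<psi> x \<partial>\<mu>) - (\<integral>x. \<psi> x \<partial>\<nu>) < e"
    if "\<psi> \<in> borel_measurable borel" "bounded (range \<psi>)" "\<And>x y. \<bar>\<psi> x - \<psi> y\<bar> \<le> d x y" for \<psi>
  proof -
    have "ereal ((\<integral>x. \<psi> x \<partial>\<mu>) - (\<integral>x. \<psi> x \<partial>\<nu>)) \<le> measure_dist d \<mu> \<nu>"
      unfolding measure_dist_def using that by (intro SUP_upper) auto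
    from le_less_trans[OF this less] show ?thesis by simp
  qed
  have "bounded (range (\<lambda>x. - \<phi> x))"
    using \<phi>(2) by (simp add: bounded_iff)
  then have "(\<integral>x. - \<phi> x \<partial>\<mu>) - (\<integral>x. - \<phi> x \<partial>\<nu>) < e"
    using \<phi>(1) lip by (intro *) (auto simp: abs_minus_commute)
  with *[OF \<phi> lip] show ?thesis by simp
qed

text \<open>
  The constant \<open>1/8\<close> stands for any number below \<open>1/2\<close>: it makes the factor \<open>1 - 2 * (1/8)\<close>
  positive. The neighbourhood \<open>U\<close>, and so the common mass \<open>a\<close>, are chosen before \<open>n\<close>; hence the
  bound \<open>1 - a * (1 - 2 * (1/8))\<close> does not depend on \<open>n\<close> and is eventually exceeded by the
  separation of the singular measures.
\<close>
lemma asymptotically_strong_feller_not_singular: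
  fixes P :: "real \<Rightarrow> 'a::polish_space \<Rightarrow> 'a measure"
  assumes P: "\<And>t. 0 \<le> t \<Longrightarrow> P t \<in> borel \<rightarrow>\<^sub>M prob_algebra borel"
    and asf: "asymptotically_strong_feller P"
    and inv: "invariant_prob P \<mu>" "invariant_prob P \<nu>"
    and v: "\<And>A. open A \<Longrightarrow> v \<in> A \<Longrightarrow> emeasure \<mu> A > 0 \<and> emeasure \<nu> A > 0"
    and Y: "Y \<in> sets borel" "emeasure \<mu> (- Y) = 0" "emeasure \<nu> Y = 0"
  shows False
proof -
  have \<mu>: "prob_space \<mu>" "sets \<mu> = sets borel" and \<nu>: "prob_space \<nu>" "sets \<nu> = sets borel"
    using inv by (auto simp: invariant_prob_def space_prob_algebra)
  interpret \<mu>: prob_space \<mu> by fact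
  interpret \<nu>: prob_space \<nu> by fact
  obtain d t where d: "totally_separating d" and t: "\<And>n. 0 < t n"
    and inf: "(INF U \<in> {U. open U \<and> v \<in> U}.
        limsup (\<lambda>n. SUP y \<in> U. measure_dist (d n) (P (t n) v) (P (t n) y))) = 0"
    using asf unfolding asymptotically_strong_feller_def by meson
  have "(INF U \<in> {U. open U \<and> v \<in> U}.
      limsup (\<lambda>n. SUP y \<in> U. measure_dist (d n) (P (t n) v) (P (t n) y))) < ereal (1/8)"
    unfolding inf by simp
  then obtain U where U: "open U" "v \<in> U"
    and lim: "limsup (\<lambda>n. SUP y \<in> U. measure_dist (d n) (P (t n) v) (P (t n) y)) < ereal (1/8)"
    unfolding INF_less_iff by blast
  define a where "a = min (measure \<mu> U) (measure \<nu> U)"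
  have "a > 0"
    using v[OF U] by (simp add: a_def \<mu>.emeasure_eq_measure \<nu>.emeasure_eq_measure)
  then have "1 - a * (1 - 2 * (1/8)) < 1" by simp
  from eventually_conj[OF singular_measures_separated[OF d \<mu> \<nu> Y this] Limsup_lessD[OF lim]]
  obtain n \<phi> where lip: "\<And>x y. \<bar>\<phi> x - \<phi> y\<bar> \<le> d n x y"
    and sep: "1 - a * (1 - 2 * (1/8)) < (\<integral>x. \<phi> x \<partial>\<mu>) - (\<integral>x. \<phi> x \<partial>\<nu>)"
    and close: "(SUP y \<in> U. measure_dist (d n) (P (t n) v) (P (t n) y)) < ereal (1/8)"
    unfolding eventually_sequentially by blast
  have tn: "0 \<le> t n" using t[of n] by simp
  note Pt = P[OF tn]
  have "pseudo_metric (d n)" using d by (simp add: totally_separating_def)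
  from continuous_on_pseudo_metric_Lipschitz[OF this lip]
  have meas: "\<phi> \<in> borel_measurable borel" by (rule borel_measurable_continuous_onI)
  have osc: "\<phi> x - \<phi> y \<le> 1" for x y
    using lip[of x y] totally_separating_le_1[OF d, of n x y] by simp
  have bdd: "bdd_below (range \<phi>)"
    using osc[of v] by (intro bdd_belowI2[of _ "\<phi> v - 1"]) (simp add: algebra_simps)
  define m where "m = (INF x. \<phi> x)"
  have lower: "m \<le> \<phi> x" for x
    unfolding m_def using bdd by (rule cINF_lower) simp
  have upper: "\<phi> x \<le> m + 1" for x
  proof -
    have "\<phi> x - 1 \<le> m"
      unfolding m_def using osc[of x] by (intro cINF_greatest) (auto simp: algebra_simps)
    then show ?thesis by simp
  qed
  have bound: "\<bar>\<phi> x\<bar> \<le> \<bar>m\<bar> + 1" for x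
    using lower[of x] upper[of x] by linarith
  then have bounded: "bounded (range \<phi>)" by (intro boundedI) auto
  define f where "f = transition_op P (t n) \<phi>"
  have range: "m \<le> f x \<and> f x \<le> m + 1" for x
  proof -
    have Px: "prob_space (P (t n) x)" "sets (P (t n) x) = sets borel"
      using measurable_space[OF Pt, of x] by (auto simp: space_prob_algebra)
    interpret prob_space "P (t n) x" by fact
    have "integrable (P (t n) x) \<phi>"
      using bound meas Px by (intro integrable_const_bound[of _ "\<bar>m\<bar> + 1"]) (auto cong: measurable_cong_sets)
    then show ?thesis
      using lower upper integral_ge_const[of \<phi> m] integral_le_const[of \<phi> "m + 1"]
      by (simp add: f_def transition_op_def)
  qed
  have "f \<in> borel_measurable borel"
    unfolding f_def transition_op_def
    by (rule measurable_compose[OF measurable_prob_algebraD[OF Pt] integral_measurable_subprob_algebra[OF meas]])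
  then have fm: "f \<in> borel_measurable \<mu>" "f \<in> borel_measurable \<nu>"
    using \<mu> \<nu> by (simp_all cong: measurable_cong_sets)
  have local: "\<bar>f y - f v\<bar> \<le> 1/8" if "y \<in> U" for y
  proof -
    have "measure_dist (d n) (P (t n) v) (P (t n) y) < ereal (1/8)"
      using SUP_upper[OF that] close by (rule le_less_trans)
    from measure_dist_Lipschitz_bound[OF meas bounded lip this] show ?thesis
      by (simp add: f_def transition_op_def abs_minus_commute)
  qed
  have "(\<integral>x. f x \<partial>\<mu>) - (\<integral>x. f x \<partial>\<nu>) \<le> 1 - a * (1 - 2 * (1/8))"
    using U \<mu> \<nu> range local \<open>a > 0\<close>
    by (intro integral_difference_le_of_local_oscillation[where A = U and m = m and c = "f v"] fm) (auto simp: a_def)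
  with sep show False
    using invariant_integral_transition[OF Pt tn inv(1) meas bound]
      invariant_integral_transition[OF Pt tn inv(2) meas bound] by (simp add: f_def)
qed

theorem corollary1p4:
  fixes P :: "real \<Rightarrow> 'a::polish_space \<Rightarrow> 'a measure"
  assumes "markov_semigroup P"
    and "feller P"
    and "weakly_topologically_irreducible P"
    and "asymptotically_strong_feller P"
  shows "\<exists>\<^sub>\<le>\<^sub>1 \<mu>. invariant_prob P \<mu>"
proof (rule Uniq_I, rule ccontr)
  fix \<mu> \<nu> assume inv: "invariant_prob P \<mu>" "invariant_prob P \<nu>" and neq: "\<mu> \<noteq> \<nu>"
  have P: "P t \<in> borel \<rightarrow>\<^sub>M prob_algebra borel" if "0 \<le> t" for t
    using assms(1) that by (simp add: markov_semigroup_def)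
  obtain \<mu>' \<nu>' Y where inv': "invariant_prob P \<mu>'" "invariant_prob P \<nu>'"
    and Y: "Y \<in> sets borel" "emeasure \<mu>' (- Y) = 0" "emeasure \<nu>' Y = 0"
    using singular_invariant_probs[OF P inv neq] .
  obtain v where v: "\<And>A. open A \<Longrightarrow> v \<in> A \<Longrightarrow> emeasure \<mu>' A > 0 \<and> emeasure \<nu>' A > 0"
    using common_support_point[OF assms(1-3) inv'] by blast
  show False
    by (rule asymptotically_strong_feller_not_singular[OF P assms(4) inv' v Y])
qed

end
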